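(* For every $n \in \mathbb{N}$ there exists a convex set $A \subset \mathbb{R}$ with $|A| = n$ such that the difference set $A - A = \{a - b : a, b \in A\}$ contains a convex subset $S$ with $|S| \geq C n^2$, where $C > 0$ is an absolute constant (independent of $n$).
   Context: A finite set $A = \{a_1 < a_2 < \dots < a_n\} \subset \mathbb{R}$ is called convex if its consecutive differences are strictly increasing, i.e. $a_{i+1} - a_i > a_i - a_{i-1}$ for all $i = 2, \dots, n-1$. *)

theory Defs
  imports Complex_Main
begin

text \<open>Additive-combinatorial convexity of a finite set of reals, unrelated to the geometric
  notion \<open>convex\<close> of the analysis library. Sets with at most two elements are convex,
  since the condition on consecutive differences is then vacuous.\<close>

definition convex_finite_set :: "real set \<Rightarrow> bool" where
  "convex_finite_set A \<longleftrightarrow> finite A \<and>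
     (\<exists>a :: nat \<Rightarrow> real.
        strict_mono_on {1..card A} a \<and> A = a ` {1..card A} \<and>
        (\<forall>i \<in> {2..card A - 1}. a (i + 1) - a i > a i - a (i - 1)))"

definition difference_set :: "real set \<Rightarrow> real set" where
  "difference_set A = {a - b | a b. a \<in> A \<and> b \<in> A}"

end

theory Submission
  imports Defs
begin

text \<open>
  Perturb the quadratic sequence \<open>8 m\<^sup>2 i + i\<^sup>2\<close>. With step width \<open>d\<close>, its differences
  \<open>v(d, j)\<close> between the indices \<open>j + d\<close> and \<open>j\<close> form an arithmetic progression in \<open>j\<close> with
  common difference \<open>2 d\<close>. Writing \<open>L = 4 m\<^sup>2\<close>, one has
  \<open>v(d + 1, d q - L) - v(d, (d + 1) q - L) = 2 d + 1\<close> for every \<open>q\<close>. Hence one can walk along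
  the progression of width \<open>d\<close>, switch to that of width \<open>d + 1\<close> with a gap strictly between
  \<open>2 d\<close> and \<open>2 (d + 1)\<close>, and so on for all \<open>d\<close> from \<open>m\<close> to \<open>2 m\<close>: the gaps never decrease.
  The values cover a range of length about \<open>8 m\<^sup>3\<close> with gaps at most \<open>4 m\<close>, so the walk has
  at least \<open>2 m\<^sup>2\<close> steps, while all indices stay below \<open>8 m + 1\<close>. Scaling by a large integer
  and adding \<open>i\<^sup>3\<close> makes the gaps strictly increasing within each progression, too.
\<close>

section \<open>Convex sets as images of finite sequences\<close>

lemma convex_finite_set_image:
  fixes f :: "nat \<Rightarrow> real"
  assumes inc: "\<And>i. Suc i < k \<Longrightarrow> f i < f (Suc i)"
    and gap: "\<And>i. Suc (Suc i) < k \<Longrightarrow> f (Suc i) - f i < f (Suc (Suc i)) - f (Suc i)"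
  shows "convex_finite_set (f ` {..<k})" "card (f ` {..<k}) = k"
proof -
  have less: "f i < f j" if "i < j" "j < k" for i j
    using that by (induction j) (auto simp: less_Suc_eq intro: inc less_trans)
  have "inj_on f {..<k}"
    by (rule inj_onI) (metis lessThan_iff less less_irrefl linorder_neqE_nat)
  then show card: "card (f ` {..<k}) = k"
    by (simp add: card_image)
  \<comment> \<open>Shifts the indices by one, because \<open>convex_finite_set\<close> enumerates
    from 1.\<close>
  define a where "a i = f (i - 1)" for i
  have "strict_mono_on {1..k} a"
    by (rule strict_mono_onI) (auto simp: a_def intro!: less)
  moreover have "f ` {..<k} = a ` {1..k}"
  proof -
    have "{1..k} = Suc ` {..<k}"
      by (simp add: lessThan_atLeast0 atLeastLessThanSuc_atLeastAtMost)
    then show ?thesis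
      by (simp add: image_image a_def)
  qed
  moreover have "a (i + 1) - a i > a i - a (i - 1)" if "i \<in> {2..k - 1}" for i
    using gap[of "i - 2"] that by (auto simp: a_def numeral_2_eq_2 Suc_diff_Suc)
  ultimately show "convex_finite_set (f ` {..<k})"
    unfolding convex_finite_set_def card by blast
qed

section \<open>The walk and the perturbed quadratic sequence\<close>

definition ceil_quot :: "int \<Rightarrow> int \<Rightarrow> int" where
  "ceil_quot m d = (4 * m\<^sup>2 + d - 1) div d"

text \<open>For d > 0, q = \<open>ceil_quot m d\<close> is the least integer that makes the entry
  index d q - L of width d + 1 nonnegative; that index is then at most d - 1.\<close>

definition switch_at :: "int \<Rightarrow> int \<Rightarrow> int" where
  "switch_at m d = (d + 1) * ceil_quot m d - 4 * m\<^sup>2"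

fun walk_step :: "int \<Rightarrow> int \<times> int \<Rightarrow> int \<times> int" where
  "walk_step m (d, j) = (if j < switch_at m d then (d, j + 1)
     else (d + 1, d * ceil_quot m d - 4 * m\<^sup>2))"

definition walk :: "int \<Rightarrow> nat \<Rightarrow> int \<times> int" where
  "walk m t = (walk_step m ^^ t) (m, 0)"

fun admissible :: "int \<Rightarrow> int \<times> int \<Rightarrow> bool" where
  "admissible m (d, j) \<longleftrightarrow> m \<le> d \<and> d \<le> 2 * m \<and> 0 \<le> j \<and> j \<le> switch_at m d"

fun quad_diff :: "int \<Rightarrow> int \<times> int \<Rightarrow> int" where
  "quad_diff m (d, j) = 8 * m\<^sup>2 * d + d * (2 * j + d)"

fun cubic_diff :: "int \<times> int \<Rightarrow> int" where
  "cubic_diff (d, j) = (j + d) ^ 3 - j ^ 3"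

text \<open>Indices stay at most 8 m, so twice any cubic term is below this factor: one unit of
  \<open>quad_diff\<close> outweighs every cubic correction.\<close>

definition scale :: "int \<Rightarrow> int" where
  "scale m = 2 * (8 * m + 1) ^ 3"

definition full_diff :: "int \<Rightarrow> int \<times> int \<Rightarrow> int" where
  "full_diff m p = scale m * quad_diff m p + cubic_diff p"

definition base_seq :: "int \<Rightarrow> int \<Rightarrow> int" where
  "base_seq m i = scale m * (8 * m\<^sup>2 * i + i\<^sup>2) + i ^ 3"

section \<open>Bounds on quotients, indices and cubic terms\<close>

lemma full_diff_eq: "full_diff m (d, j) = base_seq m (j + d) - base_seq m j"
  by (simp add: full_diff_def base_seq_def algebra_simps power2_eq_square)

lemma ceil_quot_bounds:
  assumes "d > 0"
  shows "4 * m\<^sup>2 \<le> d * ceil_quot m d" "d * ceil_quot m d \<le> 4 * m\<^sup>2 + d - 1"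
proof -
  have "d * ceil_quot m d + (4 * m\<^sup>2 + d - 1) mod d = 4 * m\<^sup>2 + d - 1"
    unfolding ceil_quot_def by simp
  then show "4 * m\<^sup>2 \<le> d * ceil_quot m d" "d * ceil_quot m d \<le> 4 * m\<^sup>2 + d - 1"
    using pos_mod_bound[OF assms, of "4 * m\<^sup>2 + d - 1"] pos_mod_sign[OF assms, of "4 * m\<^sup>2 + d - 1"]
    by linarith+
qed

lemma ceil_quot_ge:
  assumes "0 < d" "d \<le> 2 * m"
  shows "d \<le> ceil_quot m d"
proof -
  have "d * d \<le> (2 * m) * (2 * m)"
    using assms by (intro mult_mono) auto
  also have "\<dots> \<le> d * ceil_quot m d"
    using ceil_quot_bounds(1)[OF assms(1), of m] by (simp add: power2_eq_square)
  finally show ?thesis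
    using assms(1) by simp
qed

lemma ceil_quot_le:
  assumes "0 < m" "m \<le> d"
  shows "ceil_quot m d \<le> 4 * m + 1"
proof (rule ccontr)
  assume "\<not> ?thesis"
  then have "d * (4 * m + 2) \<le> d * ceil_quot m d"
    using assms by (intro mult_left_mono) auto
  also have "\<dots> \<le> 4 * m\<^sup>2 + d - 1"
    using assms by (intro ceil_quot_bounds) auto
  finally have "d * (4 * m + 2) \<le> 4 * m\<^sup>2 + d - 1" .
  moreover have "d * (4 * m + 2) = 4 * (m * d) + 2 * d"
    by (simp add: algebra_simps)
  moreover have "m\<^sup>2 \<le> m * d"
    using assms by (simp add: power2_eq_square)
  ultimately show False
    using assms by linarith
qed

lemma admissible_index_le:
  assumes "0 \<le> m" "admissible m (d, j)"
  shows "j + d \<le> 8 * m"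
proof (cases "m = 0")
  case True
  then show ?thesis
    \<comment> \<open>Here d = 0, and division by 0 yields 0, so \<open>switch_at 0 0\<close> is
      0.\<close>
    using assms by (auto simp: switch_at_def ceil_quot_def)
next
  case False
  with assms have m: "0 < m" "m \<le> d" "d \<le> 2 * m" "j \<le> switch_at m d" by auto
  \<comment> \<open>With q as above, j + d \<le> (d q - L) + q + d \<le> (d - 1) + (4 m + 1) + d
    \<le> 8 m.\<close>
  then show ?thesis
    using ceil_quot_le[OF m(1,2)] ceil_quot_bounds(2)[of d m]
    unfolding switch_at_def by (simp add: algebra_simps)
qed

lemma cubic_diff_bounds:
  assumes "0 \<le> m" "admissible m p"
  shows "0 \<le> cubic_diff p" "2 * cubic_diff p < scale m"
proof -
  obtain d j where p: "p = (d, j)" by (cases p)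
  have dj: "0 \<le> d" "0 \<le> j" "j + d \<le> 8 * m"
    using admissible_index_le assms by (auto simp: p)
  show "0 \<le> cubic_diff p"
    using dj power_mono[of j "j + d" 3] by (simp add: p)
  have "cubic_diff p \<le> (j + d) ^ 3"
    using dj by (simp add: p)
  also have "\<dots> < (8 * m + 1) ^ 3"
    using dj by (intro power_strict_mono) auto
  finally show "2 * cubic_diff p < scale m"
    by (simp add: scale_def)
qed

section \<open>Steps of the walk and their gaps\<close>

lemma admissible_step:
  assumes "0 < m" "admissible m (d, j)" "d < 2 * m"
  shows "admissible m (walk_step m (d, j))"
proof (cases "j < switch_at m d")
  case True
  then show ?thesis using assms by simp
next
  case False
  \<comment> \<open>The entry index, at most d - 1, must not overshoot the next switch index, which
    is at least d + 1.\<close>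
  have "4 * m\<^sup>2 \<le> (d + 1) * ceil_quot m (d + 1)" "d + 1 \<le> ceil_quot m (d + 1)"
    using assms by (auto intro!: ceil_quot_bounds ceil_quot_ge)
  then have "d + 1 \<le> switch_at m (d + 1)"
    by (simp add: switch_at_def algebra_simps)
  then show ?thesis
    using False assms ceil_quot_bounds[of d m] by auto
qed

lemma quad_diff_step:
  assumes "admissible m (d, j)"
  shows "quad_diff m (walk_step m (d, j)) - quad_diff m (d, j) =
    (if j < switch_at m d then 2 * d else 2 * d + 1)"
proof (cases "j < switch_at m d")
  case True
  then show ?thesis by (simp add: algebra_simps)
next
  case False
  then have "walk_step m (d, j) = (d + 1, d * ceil_quot m d - 4 * m\<^sup>2)"
    by simp
  moreover have "j = (d + 1) * ceil_quot m d - 4 * m\<^sup>2"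
    using False assms by (simp add: switch_at_def)
  \<comment> \<open>The terms in q cancel, as do 8 m^2 and 2 L; what remains is (d + 1)^2 -
    d^2.\<close>
  moreover have "quad_diff m (d + 1, d * q - 4 * m\<^sup>2) -
      quad_diff m (d, (d + 1) * q - 4 * m\<^sup>2) = 2 * d + 1" for q
    by (simp add: algebra_simps power2_eq_square)
  ultimately have "quad_diff m (walk_step m (d, j)) - quad_diff m (d, j) = 2 * d + 1"
    by metis
  with False show ?thesis by simp
qed

lemma full_diff_less_step:
  assumes "0 < m" "admissible m p" "fst p < 2 * m"
  shows "full_diff m p < full_diff m (walk_step m p)"
proof -
  obtain d j where p: "p = (d, j)" by (cases p)
  let ?q = "walk_step m p"
  have adm: "admissible m ?q"
    using admissible_step assms by (auto simp: p)
  have "1 \<le> quad_diff m ?q - quad_diff m p"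
    using quad_diff_step[of m d j] assms by (auto simp: p split: if_splits)
  then have "scale m * 1 \<le> scale m * (quad_diff m ?q - quad_diff m p)"
    using assms by (intro mult_left_mono) (auto simp: scale_def)
  moreover have "cubic_diff p < scale m + cubic_diff ?q"
    using cubic_diff_bounds[of m p] cubic_diff_bounds[of m ?q] adm assms by auto
  ultimately show ?thesis
    by (simp add: full_diff_def algebra_simps)
qed

lemma full_diff_gap_less:
  fixes m p
  defines "q \<equiv> walk_step m p"
  defines "r \<equiv> walk_step m q"
  assumes m: "0 < m" and p: "admissible m p" "fst p < 2 * m" and q: "fst q < 2 * m"
  shows "full_diff m q - full_diff m p < full_diff m r - full_diff m q"
proof -
  obtain d j where pe: "p = (d, j)" by (cases p)
  have adm_q: "admissible m q"
    using admissible_step m p by (auto simp: pe q_def)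
  then have adm_r: "admissible m r"
    using admissible_step m q by (cases q) (auto simp: r_def)
  show ?thesis
  proof (cases "j + 1 < switch_at m d")
    case True
    \<comment> \<open>Both quadratic gaps equal 2 d; strictness comes from the second difference 6 d
      of the cubic part.\<close>
    then have "q = (d, j + 1)" "r = (d, j + 2)"
      by (auto simp: q_def r_def pe)
    moreover have "0 < d"
      using m p by (simp add: pe)
    ultimately show ?thesis
      by (simp add: full_diff_def pe algebra_simps power2_eq_square power3_eq_cube)
  next
    case False
    \<comment> \<open>Around a switch the gaps run 2 d, then 2 d + 1, then at least 2 d + 2.\<close>
    have "quad_diff m q - quad_diff m p + 1 \<le> quad_diff m r - quad_diff m q"
    proof (cases "j < switch_at m d")
      case True
      then have qe: "q = (d, j + 1)"
        by (simp add: q_def pe)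
      show ?thesis
        using quad_diff_step[of m d j] quad_diff_step[of m d "j + 1"] True False p adm_q
        unfolding r_def qe by (simp add: q_def pe)
    next
      case nless: False
      define j' where "j' = d * ceil_quot m d - 4 * m\<^sup>2"
      have qe: "q = (d + 1, j')"
        using nless by (simp add: q_def pe j'_def)
      have "quad_diff m q - quad_diff m p = 2 * d + 1"
        using quad_diff_step[of m d j] p(1) nless unfolding q_def pe by simp
      moreover have "quad_diff m r - quad_diff m q \<ge> 2 * (d + 1)"
        using quad_diff_step[of m "d + 1" j'] adm_q unfolding r_def qe by (simp split: if_splits)
      ultimately show ?thesis by simp
    qed
    then have "scale m * (quad_diff m q - quad_diff m p + 1) \<le>
        scale m * (quad_diff m r - quad_diff m q)"
      using m by (intro mult_left_mono) (auto simp: scale_def)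
    moreover have "2 * cubic_diff q < scale m + cubic_diff p + cubic_diff r"
      using cubic_diff_bounds[of m p] cubic_diff_bounds[of m q] cubic_diff_bounds[of m r]
        adm_q adm_r m p by auto
    ultimately show ?thesis
      by (simp add: full_diff_def algebra_simps)
  qed
qed

text \<open>The bound on \<open>quad_diff\<close> serves as a clock: reaching width \<open>2 m\<close> takes at least
  \<open>2 m\<^sup>2\<close> steps.\<close>

lemma walk_invariant:
  assumes "0 \<le> m"
  shows "int t \<le> 2 * m\<^sup>2 \<Longrightarrow> admissible m (walk m t) \<and>
    quad_diff m (walk m t) \<le> 8 * m ^ 3 + m\<^sup>2 + 4 * m * int t \<and>
    (0 < m \<longrightarrow> fst (walk m t) < 2 * m)"
proof (induction t)
  case 0
  have "0 \<le> switch_at m m"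
  proof (cases "m = 0")
    case True
    then show ?thesis by (simp add: switch_at_def ceil_quot_def)
  next
    case False
    then show ?thesis
      using ceil_quot_bounds(1)[of m m] ceil_quot_ge[of m m] assms
      by (simp add: switch_at_def algebra_simps)
  qed
  then show ?case
    using assms by (simp add: walk_def algebra_simps power2_eq_square power3_eq_cube)
next
  case (Suc t)
  have m: "0 < m"
    using Suc.prems assms by (cases "m = 0") auto
  obtain d j where w: "walk m t = (d, j)" by (cases "walk m t")
  obtain d' j' where w': "walk m (Suc t) = (d', j')" by (cases "walk m (Suc t)")
  have step: "(d', j') = walk_step m (d, j)"
    using w w' by (simp add: walk_def)
  have IH: "admissible m (d, j)" "quad_diff m (d, j) \<le> 8 * m ^ 3 + m\<^sup>2 + 4 * m * int t"
    "d < 2 * m"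
    using Suc m by (auto simp: w)
  have adm: "admissible m (d', j')"
    unfolding step using m IH by (intro admissible_step)
  have "quad_diff m (d', j') \<le> quad_diff m (d, j) + 4 * m"
    using quad_diff_step[OF IH(1)] IH(3) unfolding step by (simp split: if_splits)
  with IH(2) have quad: "quad_diff m (d', j') \<le> 8 * m ^ 3 + m\<^sup>2 + 4 * m * int (Suc t)"
    by (simp add: algebra_simps)
  \<comment> \<open>Width 2 m needs a value of at least 16 m^3 + 4 m^2, but 2 m^2 steps of at most 4
    m from 8 m^3 + m^2 reach only 16 m^3 + m^2.\<close>
  have "d' \<noteq> 2 * m"
  proof
    assume d': "d' = 2 * m"
    have "0 \<le> m * j'" using adm m by simp
    then have "16 * m ^ 3 + 4 * m\<^sup>2 \<le> quad_diff m (d', j')"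
      by (simp add: d' algebra_simps power2_eq_square power3_eq_cube)
    also note quad
    also have "4 * m * int (Suc t) \<le> 4 * m * (2 * m\<^sup>2)"
      using Suc.prems m by (intro mult_left_mono) auto
    finally have "4 * m\<^sup>2 \<le> m\<^sup>2"
      by (simp add: algebra_simps power2_eq_square power3_eq_cube)
    then show False using m by simp
  qed
  with adm quad show ?case
    unfolding w' by auto
qed

section \<open>Choice of parameters and counting\<close>

theorem theorem1:
  shows "\<exists>C::real. C > 0 \<and>
    (\<forall>n::nat. \<exists>A::real set. convex_finite_set A \<and> card A = n \<and>
      (\<exists>S. S \<subseteq> difference_set A \<and> convex_finite_set S \<and>
        real (card S) \<ge> C * (real n)\<^sup>2))"
proof (intro exI[of _ "1 / 128 :: real"] conjI allI)
  fix n :: nat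
  \<comment> \<open>The largest k with 8 k < n when n > 0, so that all indices up to 8 m occur in
    A.\<close>
  define k where "k = (n - 1) div 8"
  define m where "m = int k"
  define a where "a i = real_of_int (base_seq m (int i))" for i :: nat
  define s where "s t = real_of_int (full_diff m (walk m t))" for t
  \<comment> \<open>Counts the walk positions at times 0 to 2 k^2. For n = 0 the difference set is
    empty, so S must be too.\<close>
  define T where "T = (if n = 0 then 0 else Suc (2 * k\<^sup>2))"
  have m: "0 \<le> m" and scale: "0 < scale m"
    by (simp_all add: m_def scale_def)
  have "a i < a (Suc i)" for i
  proof -
    have "int i ^ 3 < int (Suc i) ^ 3" "(int i)\<^sup>2 < (int (Suc i))\<^sup>2"
      by (intro power_strict_mono; simp)+
    moreover have "8 * m\<^sup>2 * int i \<le> 8 * m\<^sup>2 * int (Suc i)"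
      by (intro mult_left_mono) auto
    ultimately show ?thesis
      unfolding a_def base_seq_def of_int_less_iff using scale
      by (intro add_strict_mono mult_strict_left_mono add_le_less_mono)
  qed
  moreover have "a (Suc i) - a i < a (Suc (Suc i)) - a (Suc i)" for i
  proof -
    have "base_seq m (int (Suc (Suc i))) - 2 * base_seq m (int (Suc i)) + base_seq m (int i)
        = 2 * scale m + 6 * int i + 6"
      by (simp add: base_seq_def algebra_simps power2_eq_square power3_eq_cube)
    then have "base_seq m (int (Suc i)) - base_seq m (int i)
        < base_seq m (int (Suc (Suc i))) - base_seq m (int (Suc i))"
      using scale by linarith
    then show ?thesis
      unfolding a_def of_int_diff[symmetric] of_int_less_iff .
  qed
  ultimately have A: "convex_finite_set (a ` {..<n})" "card (a ` {..<n}) = n"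
    by (auto intro!: convex_finite_set_image)
  have walk_Suc: "walk m (Suc t) = walk_step m (walk m t)" for t
    by (simp add: walk_def)
  have inv: "admissible m (walk m t)" "0 < m \<longrightarrow> fst (walk m t) < 2 * m" if "t < T" for t
  proof -
    have "t \<le> 2 * k\<^sup>2"
      using that by (simp add: T_def split: if_splits)
    then have "int t \<le> 2 * m\<^sup>2"
      unfolding m_def by (metis of_nat_le_iff of_nat_mult of_nat_numeral of_nat_power)
    from walk_invariant[OF m this]
    show "admissible m (walk m t)" "0 < m \<longrightarrow> fst (walk m t) < 2 * m" by auto
  qed
  \<comment> \<open>If k = 0, the walk has at most one position and no step to check.\<close>
  have m_pos: "0 < m" if "Suc t < T" for t
    using that by (cases "k = 0") (auto simp: T_def m_def split: if_splits)
  have s_less: "s t < s (Suc t)" if "Suc t < T" for t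
    using full_diff_less_step[of m "walk m t"] inv[of t] m_pos[of t] that
    by (simp add: s_def walk_Suc)
  have s_gap: "s (Suc t) - s t < s (Suc (Suc t)) - s (Suc t)" if t: "Suc (Suc t) < T" for t
  proof -
    have "full_diff m (walk m (Suc t)) - full_diff m (walk m t)
        < full_diff m (walk m (Suc (Suc t))) - full_diff m (walk m (Suc t))"
      unfolding walk_Suc
      using t inv[of t] inv[of "Suc t"] m_pos[of t]
      by (intro full_diff_gap_less) (auto simp: walk_Suc)
    then show ?thesis
      unfolding s_def of_int_diff[symmetric] of_int_less_iff .
  qed
  note S = convex_finite_set_image[of T s, OF s_less s_gap]
  have "s ` {..<T} \<subseteq> difference_set (a ` {..<n})"
  proof (rule image_subsetI)
    fix t assume "t \<in> {..<T}"
    then have t: "t < T" by simp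
    obtain d j where w: "walk m t = (d, j)" by (cases "walk m t")
    have adm: "admissible m (d, j)"
      using inv(1)[OF t] by (simp add: w)
    have dj: "0 \<le> d" "0 \<le> j" "j + d \<le> 8 * m"
      using admissible_index_le[OF m adm] adm m by auto
    have "0 < n"
      using t by (simp add: T_def split: if_splits)
    then have "8 * m < int n"
      by (simp add: m_def k_def)
    with dj have "nat (j + d) < n" "nat j < n" by auto
    moreover have "s t = a (nat (j + d)) - a (nat j)"
      using dj by (simp add: s_def a_def w full_diff_eq)
    ultimately show "s t \<in> difference_set (a ` {..<n})"
      unfolding difference_set_def by blast
  qed
  moreover have "1 / 128 * (real n)\<^sup>2 \<le> real T"
  proof (cases "n = 0")
    case True
    then show ?thesis by simp
  next
    case False
    then have "n \<le> 8 * k + 8"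
      by (simp add: k_def)
    then have "(real n)\<^sup>2 \<le> (8 * real k + 8)\<^sup>2"
      by (intro power_mono) auto
    \<comment> \<open>Source of 1/128: (k + 1)^2 \<le> 2 (1 + 2 k^2), with the defect written as a
      sum of squares.\<close>
    also have "\<dots> = 128 * (1 + 2 * (real k)\<^sup>2) - 64 * ((real k - 1)\<^sup>2 + 2 * (real k)\<^sup>2)"
      by (simp add: algebra_simps power2_eq_square)
    also have "\<dots> \<le> 128 * (1 + 2 * (real k)\<^sup>2)"
      unfolding diff_le_eq le_add_same_cancel1
      by (intro mult_nonneg_nonneg add_nonneg_nonneg) auto
    finally show ?thesis
      using False by (simp add: T_def)
  qed
  ultimately show "\<exists>A::real set. convex_finite_set A \<and> card A = n \<and>
      (\<exists>S. S \<subseteq> difference_set A \<and> convex_finite_set S \<and>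
        real (card S) \<ge> 1 / 128 * (real n)\<^sup>2)"
    using A S by (intro exI[of _ "a ` {..<n}"] exI[of _ "s ` {..<T}"] conjI) auto
qed simp

end
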